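(* Let $T>0$, $I=[0,T]$, $q\in(0,1]$, $0<t_1\le t_2\le\cdots\le t_k<T$, $\iota_1,\dots,\iota_k\in R$, $x_0\in R^n$, and for $j=1,\dots,m$ let $S_j,D_j:R^m\times R^n\to R$ and $a_j,b_j:R^{m-1}\to R$; let $\chi:I\times R^n\to R^n$ and $\vartheta:I\times R^n\times R^m\to R^n$. Assume: (A1) there are constants $\eta_{SD},l_{Sj},l_{Dj}>0$ ($j=1,\dots,m$) such that for all $x\in R^n$ and $u^1,u^2\in R^m$, $$\sum_{j=1}^mS_j(u^1,x)(u_j^2-u_j^1)+\sum_{j=1}^mD_j(u^1,x)(u_j^1-u_j^2)\ge 0$$ implies $$\sum_{j=1}^mS_j(u^2,x)(u_j^2-u_j^1)+\sum_{j=1}^mD_j(u^2,x)(u_j^1-u_j^2)\ge\eta_{SD}\|u^2-u^1\|^2,$$ and for all $x^1,x^2\in R^n$, $u^1,u^2\in R^m$ and each $j$, $|S_j(u^1,x^1)-S_j(u^2,x^2)|\le l_{Sj}(\|x^1-x^2\|+\|u^1-u^2\|)$ and $|D_j(u^1,x^1)-D_j(u^2,x^2)|\le l_{Dj}(\|x^1-x^2\|+\|u^1-u^2\|)$; (A2) for each $j$, $a_j(u_{-j})=\phi_j(u_{-j})+c_j$ and $b_j(u_{-j})=\phi_j(u_{-j})+d_j$ for all $u_{-j}\in R^{m-1}$, where $c_j<d_j$ are positive constants and $\phi_j:R^{m-1}\to R$ is $l_j$-Lipschitz, and, with $l=(l_1,\dots,l_m)^\top$, $l_S=(l_{S1},\dots,l_{Sm})^\top$,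 $l_D=(l_{D1},\dots,l_{Dm})^\top$, $$2\frac{\|l\|_1^2}{\eta_{SD}^2}\left((\|l_S\|_1+\|l_D\|_1)\sqrt{4(\|l_S\|_1+\|l_D\|_1)^2+2\eta_{SD}^2}+2(\|l_S\|_1+\|l_D\|_1)^2+\eta_{SD}^2\right)<1;$$ (A3) $\vartheta$ is continuous and there is $l_\vartheta>0$ with $\|\vartheta(s,x^2,u^2)-\vartheta(s,x^1,u^1)\|\le l_\vartheta(\|x^2-x^1\|+\|u^2-u^1\|)$ for all $s\in I$, $x^1,x^2\in R^n$, $u^1,u^2\in R^m$; (A4) $\chi$ is continuous and there is $l_\chi>0$ with $\|\chi(s,x^2)-\chi(s,x^1)\|\le l_\chi\|x^2-x^1\|$ for all $s\in I$, $x^1,x^2\in R^n$; (A5) $0<\sum_{i=1}^k|\iota_i|<1$. Then the price control problem (PCP) $$\begin{cases}{}^{C}_{0}\mathrm{D}_s^{q}x(s)=\chi(s,x(s))+\vartheta(s,x(s),u(s)), & s\in I,\\ \langle S(u(s),x(s))-D(u(s),x(s)),v-u(s)\rangle\ge 0\ \ \forall v\in K(u(s)), & s\in I,\\ x(0)=x_0+\sum_{i=1}^k\iota_ix(t_i)\end{cases}$$ is Mittag-Leffler-Hyers-Ulam stable with respect to $\mathrm{E}_q$.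
   Context: $\|\cdot\|$ is the Euclidean norm and $\|\cdot\|_1$ the $1$-norm. For $u\in R^m$, $u_{-j}\in R^{m-1}$ denotes $u$ with its $j$-th component omitted. $S=(S_1,\dots,S_m)^\top$, $D=(D_1,\dots,D_m)^\top$ and, for $u\in R^m$, $K(u)=\{w\in R^m: a_j(u_{-j})\le w_j\le b_j(u_{-j}),\ j=1,\dots,m\}$. ${}^{C}_{0}\mathrm{D}_s^{q}$ is the Caputo fractional derivative of order $q$. $\mathrm{E}_q(t)=\sum_{n=0}^\infty\frac{t^n}{\Gamma(nq+1)}$ is the Mittag-Leffler function. A solution of the PCP is a pair $(x,u)\in C(I,R^n)\times C(I,R^m)$ such that for all $s\in I$: $x(s)=x_0+\sum_{i=1}^k\iota_ix(t_i)+\frac{1}{\Gamma(q)}\int_0^s(s-\zeta)^{q-1}[\chi(\zeta,x(\zeta))+\vartheta(\zeta,x(\zeta),u(\zeta))]\,d\zeta$, $u(s)\in K(u(s))$, and $\langle S(u(s),x(s))-D(u(s),x(s)),v-u(s)\rangle\ge 0$ for all $v\in K(u(s))$. Mittag-Leffler-Hyers-Ulam stability with respect to $\mathrm{E}_q$ means: there exists $c>0$ such that for each $\varepsilon>0$ and each solution $(z,\upsilon)\in C(I,R^n)\times C(I,R^m)$ of the system $$\begin{cases}\left\|{}^{C}_{0}\mathrm{D}_s^{q}z(s)-\chi(s,z(s))-\vartheta(s,z(s),\upsilon(s))\right\|\le\varepsilon, & s\in I,\\ \upsilon(s)\in K(\upsilon(s)),\ \langle S(\upsilon(s),z(s))-D(\upsilon(s),z(s)),v-\upsilon(s)\rangle\ge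 0\ \ \forall v\in K(\upsilon(s)), & s\in I,\\ z(0)=x(0),\end{cases}$$ where $x$ is the trajectory (first component) of a solution $(x,u)$ of the PCP, there exists such a solution $(x,u)$ of the PCP with $\|z(s)-x(s)\|\le c\,\varepsilon\,\mathrm{E}_q(s)$ for all $s\in I$. The first line of the system holds iff there is $h\in C(I,R^n)$ with $\|h(s)\|\le\varepsilon$ on $I$ and $z(s)=z(0)+\frac{1}{\Gamma(q)}\int_0^s(s-\zeta)^{q-1}[\chi(\zeta,z(\zeta))+\vartheta(\zeta,z(\zeta),\upsilon(\zeta))+h(\zeta)]\,d\zeta$ for all $s\in I$. *)

theory Defs
  imports "HOL-Analysis.Analysis"
begin

text \<open>Points of \<open>R\<^sup>m\<^sup>-\<^sup>1\<close> that arise by deleting the \<open>j\<close>-th component are families indexed by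
  \<open>- {j}\<close>, i.e. extensional functions. This covers \<open>m = 1\<close>, where the space is a single point.\<close>

definition omit_space :: "'m \<Rightarrow> ('m \<Rightarrow> real) set" where
  "omit_space j = (- {j}) \<rightarrow>\<^sub>E UNIV"

definition omit :: "'m \<Rightarrow> real ^ 'm \<Rightarrow> ('m \<Rightarrow> real)" where
  "omit j u = restrict (\<lambda>i. u $ i) (- {j})"

definition omit_dist :: "'m::finite \<Rightarrow> ('m \<Rightarrow> real) \<Rightarrow> ('m \<Rightarrow> real) \<Rightarrow> real" where
  "omit_dist j p r = L2_set (\<lambda>i. p i - r i) (- {j})"

text \<open>As with \<^const>\<open>lipschitz_on\<close>, the constant has to be nonnegative.\<close>

definition omit_lipschitz :: "'m::finite \<Rightarrow> real \<Rightarrow> (('m \<Rightarrow> real) \<Rightarrow> real) \<Rightarrow> bool" where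
  "omit_lipschitz j L f \<longleftrightarrow> 0 \<le> L \<and>
     (\<forall>p\<in>omit_space j. \<forall>r\<in>omit_space j. \<bar>f p - f r\<bar> \<le> L * omit_dist j p r)"

definition norm1 :: "real ^ 'm::finite \<Rightarrow> real" where
  "norm1 v = (\<Sum>j\<in>UNIV. \<bar>v $ j\<bar>)"

definition mittag_leffler :: "real \<Rightarrow> real \<Rightarrow> real" where
  "mittag_leffler q s = (\<Sum>n. s ^ n / Gamma (real n * q + 1))"

text \<open>Riemann-Liouville integral with base point \<open>0\<close>. Order \<open>0\<close>, needed for Caputo derivatives of
  order \<open>1\<close>, is the identity by convention; the kernel formula would give \<open>0\<close> there, since
  \<open>Gamma 0 = 0\<close> in the library.\<close>

definition frac_integral :: "real \<Rightarrow> (real \<Rightarrow> 'a::banach) \<Rightarrow> real \<Rightarrow> 'a" where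
  "frac_integral r f s =
     (if r = 0 then f s
      else (1 / Gamma r) *\<^sub>R integral {0..s} (\<lambda>\<zeta>. ((s - \<zeta>) powr (r - 1)) *\<^sub>R f \<zeta>))"

text \<open>Caputo derivative of order \<open>q \<in> (0,1]\<close> for continuous \<open>z\<close>: the Riemann-Liouville derivative
  of \<open>z - z(0)\<close> (one-sided at the end points). For absolutely continuous \<open>z\<close> it agrees almost
  everywhere with the fractional integral of order \<open>1 - q\<close> of \<open>z'\<close>. For continuous \<open>z\<close> and \<open>g\<close>
  it says exactly that \<open>z\<close> equals \<open>z(0)\<close> plus the fractional integral of order \<open>q\<close> of \<open>g\<close>.\<close>

definition has_caputo_derivative_on ::
  "real \<Rightarrow> real \<Rightarrow> (real \<Rightarrow> 'a::banach) \<Rightarrow> (real \<Rightarrow> 'a) \<Rightarrow> bool" where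
  "has_caputo_derivative_on q T z g \<longleftrightarrow>
     (\<forall>s\<in>{0..T}. (frac_integral (1 - q) (\<lambda>\<zeta>. z \<zeta> - z 0) has_vector_derivative g s)
                    (at s within {0..T}))"

definition constraint_set ::
  "('m \<Rightarrow> ('m \<Rightarrow> real) \<Rightarrow> real) \<Rightarrow> ('m \<Rightarrow> ('m \<Rightarrow> real) \<Rightarrow> real) \<Rightarrow> real ^ 'm \<Rightarrow> (real ^ 'm) set" where
  "constraint_set a b u = {w. \<forall>j. a j (omit j u) \<le> w $ j \<and> w $ j \<le> b j (omit j u)}"

definition qvi_solution ::
  "('m::finite \<Rightarrow> real ^ 'm \<Rightarrow> real ^ 'n \<Rightarrow> real) \<Rightarrow> ('m \<Rightarrow> real ^ 'm \<Rightarrow> real ^ 'n \<Rightarrow> real) \<Rightarrow>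
   ('m \<Rightarrow> ('m \<Rightarrow> real) \<Rightarrow> real) \<Rightarrow> ('m \<Rightarrow> ('m \<Rightarrow> real) \<Rightarrow> real) \<Rightarrow>
   real ^ 'n \<Rightarrow> real ^ 'm \<Rightarrow> bool" where
  "qvi_solution S D a b x u \<longleftrightarrow>
     u \<in> constraint_set a b u \<and>
     (\<forall>v\<in>constraint_set a b u. ((\<chi> j. S j u x) - (\<chi> j. D j u x)) \<bullet> (v - u) \<ge> 0)"

definition pcp_solution ::
  "real \<Rightarrow> real \<Rightarrow> nat \<Rightarrow> (nat \<Rightarrow> real) \<Rightarrow> (nat \<Rightarrow> real) \<Rightarrow> real ^ 'n::finite \<Rightarrow>
   (real \<Rightarrow> real ^ 'n \<Rightarrow> real ^ 'n) \<Rightarrow> (real \<Rightarrow> real ^ 'n \<Rightarrow> real ^ 'm::finite \<Rightarrow> real ^ 'n) \<Rightarrow>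
   ('m \<Rightarrow> real ^ 'm \<Rightarrow> real ^ 'n \<Rightarrow> real) \<Rightarrow> ('m \<Rightarrow> real ^ 'm \<Rightarrow> real ^ 'n \<Rightarrow> real) \<Rightarrow>
   ('m \<Rightarrow> ('m \<Rightarrow> real) \<Rightarrow> real) \<Rightarrow> ('m \<Rightarrow> ('m \<Rightarrow> real) \<Rightarrow> real) \<Rightarrow>
   (real \<Rightarrow> real ^ 'n) \<Rightarrow> (real \<Rightarrow> real ^ 'm) \<Rightarrow> bool" where
  "pcp_solution T q k t \<iota> x0 chi theta S D a b x u \<longleftrightarrow>
     continuous_on {0..T} x \<and> continuous_on {0..T} u \<and>
     (\<forall>s\<in>{0..T}.
        x s = x0 + (\<Sum>i=1..k. \<iota> i *\<^sub>R x (t i))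
              + frac_integral q (\<lambda>\<zeta>. chi \<zeta> (x \<zeta>) + theta \<zeta> (x \<zeta>) (u \<zeta>)) s \<and>
        qvi_solution S D a b (x s) (u s))"

text \<open>The perturbed system, without the initial condition. The Caputo derivative of \<open>z\<close> is required
  to exist and be continuous, so that the defect \<open>h(s) = g(s) - chi(s,z(s)) - theta(s,z(s),w(s))\<close>
  is a continuous function bounded by \<open>\<epsilon>\<close>.\<close>

definition pcp_approx_solution ::
  "real \<Rightarrow> real \<Rightarrow> (real \<Rightarrow> real ^ 'n::finite \<Rightarrow> real ^ 'n) \<Rightarrow>
   (real \<Rightarrow> real ^ 'n \<Rightarrow> real ^ 'm::finite \<Rightarrow> real ^ 'n) \<Rightarrow>
   ('m \<Rightarrow> real ^ 'm \<Rightarrow> real ^ 'n \<Rightarrow> real) \<Rightarrow> ('m \<Rightarrow> real ^ 'm \<Rightarrow> real ^ 'n \<Rightarrow> real) \<Rightarrow>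
   ('m \<Rightarrow> ('m \<Rightarrow> real) \<Rightarrow> real) \<Rightarrow> ('m \<Rightarrow> ('m \<Rightarrow> real) \<Rightarrow> real) \<Rightarrow> real \<Rightarrow>
   (real \<Rightarrow> real ^ 'n) \<Rightarrow> (real \<Rightarrow> real ^ 'm) \<Rightarrow> bool" where
  "pcp_approx_solution T q chi theta S D a b \<epsilon> z w \<longleftrightarrow>
     continuous_on {0..T} z \<and> continuous_on {0..T} w \<and>
     (\<exists>g. continuous_on {0..T} g \<and> has_caputo_derivative_on q T z g \<and>
          (\<forall>s\<in>{0..T}. norm (g s - chi s (z s) - theta s (z s) (w s)) \<le> \<epsilon>)) \<and>
     (\<forall>s\<in>{0..T}. qvi_solution S D a b (z s) (w s))"

text \<open>The approximate solution starts at the initial value of some solution of the PCP, and the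
  solution found near it is again one with that initial value.\<close>

definition pcp_mlhu_stable ::
  "real \<Rightarrow> real \<Rightarrow> nat \<Rightarrow> (nat \<Rightarrow> real) \<Rightarrow> (nat \<Rightarrow> real) \<Rightarrow> real ^ 'n::finite \<Rightarrow>
   (real \<Rightarrow> real ^ 'n \<Rightarrow> real ^ 'n) \<Rightarrow> (real \<Rightarrow> real ^ 'n \<Rightarrow> real ^ 'm::finite \<Rightarrow> real ^ 'n) \<Rightarrow>
   ('m \<Rightarrow> real ^ 'm \<Rightarrow> real ^ 'n \<Rightarrow> real) \<Rightarrow> ('m \<Rightarrow> real ^ 'm \<Rightarrow> real ^ 'n \<Rightarrow> real) \<Rightarrow>
   ('m \<Rightarrow> ('m \<Rightarrow> real) \<Rightarrow> real) \<Rightarrow> ('m \<Rightarrow> ('m \<Rightarrow> real) \<Rightarrow> real) \<Rightarrow> bool" where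
  "pcp_mlhu_stable T q k t \<iota> x0 chi theta S D a b \<longleftrightarrow>
     (\<exists>c>0. \<forall>\<epsilon>>0. \<forall>z w.
        pcp_approx_solution T q chi theta S D a b \<epsilon> z w \<and>
        (\<exists>x u. pcp_solution T q k t \<iota> x0 chi theta S D a b x u \<and> z 0 = x 0) \<longrightarrow>
        (\<exists>x u. pcp_solution T q k t \<iota> x0 chi theta S D a b x u \<and> z 0 = x 0 \<and>
               (\<forall>s\<in>{0..T}. norm (z s - x s) \<le> c * \<epsilon> * mittag_leffler q s)))"

end

theory Submission
  imports Defs
begin

text \<open>
  Any solution \<open>(x, u)\<close> with \<open>x 0 = z 0\<close> works as the solution close to the approximate solution
  \<open>(z, w)\<close>; the definition of stability supplies one.

  The control can be eliminated. At each time \<open>w s\<close> and \<open>u s\<close> solve the same quasi-variational inequality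
  with parameters \<open>z s\<close> and \<open>x s\<close>. Shifting one solution into the constraint set of the other and using
  strong pseudomonotonicity shows \<open>norm (w s - u s) \<le> \<kappa> * norm (z s - x s)\<close>, where the smallness
  condition on the Lipschitz constants makes \<open>\<kappa>\<close> finite (\<open>qvi_solution_lipschitz\<close>).

  The Caputo inequality becomes an integral equation: \<open>z\<close> equals \<open>z 0\<close> plus the fractional integral of order \<open>q\<close>
  of its Caputo derivative (\<open>caputo_derivative_imp_integral_equation\<close>). The key is the semigroup law of
  fractional integrals, verified on powers with the Beta integral and extended to continuous functions by
  polynomial approximation. Since the initial values agree, \<open>z - x\<close> is the fractional integral of a
  function of norm at most \<open>\<epsilon> + L * norm (z - x)\<close>.

  A Gronwall argument with an exponential weight (\<open>fractional_gronwall\<close>) then gives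
  \<open>norm (z s - x s) \<le> C * \<epsilon>\<close> with \<open>C\<close> depending on \<open>L\<close>, \<open>q\<close> and \<open>T\<close> only. This is the claim, because
  the Mittag-Leffler function is at least \<open>1\<close> on \<open>[0, T]\<close> (\<open>one_le_mittag_leffler\<close>).
\<close>

section \<open>Fractional integrals of continuous functions\<close>

text \<open>The substitution \<open>\<zeta> = s * t\<close> turns the integral into the Beta integral. This explicit formula is what
  replaces Fubini's theorem below.\<close>

lemma frac_kernel_powr_has_integral:
  fixes s \<alpha> p :: real
  assumes \<alpha>: "0 < \<alpha>" and p: "-1 < p" and s: "0 \<le> s"
  shows "((\<lambda>\<zeta>. (s - \<zeta>) powr (\<alpha> - 1) * \<zeta> powr p) has_integral
    (Beta (p + 1) \<alpha> * s powr (p + \<alpha>))) {0..s}"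
proof (cases "s = 0")
  case True
  then show ?thesis by (simp add: has_integral_refl)
next
  case False
  with s have s0: "0 < s" by simp
  define h :: "real \<Rightarrow> real" where "h = (\<lambda>t. t powr p * (1 - t) powr (\<alpha> - 1))"
  have "(h has_integral Beta (p + 1) \<alpha>) (cbox 0 1)"
    using has_integral_Beta_real[of "p + 1" \<alpha>] \<alpha> p by (simp add: h_def)
  from has_integral_affinity'[OF this, of "1 / s" 0] s0
  have "((\<lambda>\<zeta>. h (\<zeta> / s)) has_integral (s * Beta (p + 1) \<alpha>)) {0..s}"
    by (simp add: divide_inverse mult.commute)
  from has_integral_mult_right[OF this, of "s powr (p + \<alpha> - 1)"]
  have "((\<lambda>\<zeta>. s powr (p + \<alpha> - 1) * h (\<zeta> / s)) has_integral (Beta (p + 1) \<alpha> * s powr (p + \<alpha>))) {0..s}"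
    using s0 by (simp add: powr_diff mult.commute)
  moreover have "s powr (p + \<alpha> - 1) * h (\<zeta> / s) = (s - \<zeta>) powr (\<alpha> - 1) * \<zeta> powr p"
    if "\<zeta> \<in> {0..s}" for \<zeta>
  proof -
    have "(1 - \<zeta> / s) = (s - \<zeta>) / s" using s0 by (simp add: field_simps)
    then have "h (\<zeta> / s) = (\<zeta> powr p / s powr p) * ((s - \<zeta>) powr (\<alpha> - 1) / s powr (\<alpha> - 1))"
      using that s0 by (simp add: h_def powr_divide)
    moreover have "s powr (p + \<alpha> - 1) = s powr p * s powr (\<alpha> - 1)"
      by (simp flip: powr_add add: algebra_simps)
    ultimately show ?thesis using s0 by simp
  qed
  ultimately show ?thesis by (rule has_integral_eq[rotated])
qed

lemma frac_kernel_integrable_on: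
  fixes s \<alpha> :: real and f :: "real \<Rightarrow> 'a::euclidean_space"
  assumes \<alpha>: "0 < \<alpha>" and s: "0 \<le> s" and f: "continuous_on {0..s} f"
  shows "(\<lambda>\<zeta>. ((s - \<zeta>) powr (\<alpha> - 1)) *\<^sub>R f \<zeta>) integrable_on {0..s}"
proof -
  have "((\<lambda>\<zeta>. (s - \<zeta>) powr (\<alpha> - 1)) has_integral (Beta (0 + 1) \<alpha> * s powr (0 + \<alpha>))) {0..s}"
    by (rule has_integral_spike_finite[OF _ _ frac_kernel_powr_has_integral[OF \<alpha> _ s, of 0], of "{0}"]) auto
  then have "(\<lambda>\<zeta>. (s - \<zeta>) powr (\<alpha> - 1)) absolutely_integrable_on {0..s}"
    by (intro nonnegative_absolutely_integrable_1) (auto simp: integrable_on_def)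
  moreover have "f \<in> borel_measurable (lebesgue_on {0..s})"
    by (rule continuous_imp_measurable_on_sets_lebesgue[OF f]) simp
  moreover have "bounded (f ` {0..s})"
    by (intro compact_imp_bounded compact_continuous_image f) simp
  moreover have "bilinear (\<lambda>(x::'a) (r::real). r *\<^sub>R x)"
    by (auto simp: bilinear_def linear_iff algebra_simps)
  ultimately have "(\<lambda>\<zeta>. ((s - \<zeta>) powr (\<alpha> - 1)) *\<^sub>R f \<zeta>) absolutely_integrable_on {0..s}"
    by (intro absolutely_integrable_bounded_measurable_product[where h = "\<lambda>x r. r *\<^sub>R x"]) auto
  then show ?thesis
    by (rule set_lebesgue_integral_eq_integral)
qed

lemma frac_integral_diff:
  fixes f g :: "real \<Rightarrow> 'a::euclidean_space"
  assumes "0 < \<alpha>" "0 \<le> s" "continuous_on {0..s} f" "continuous_on {0..s} g"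
  shows "frac_integral \<alpha> (\<lambda>\<zeta>. f \<zeta> - g \<zeta>) s = frac_integral \<alpha> f s - frac_integral \<alpha> g s"
  using assms
  by (simp add: frac_integral_def scaleR_diff_right frac_kernel_integrable_on Henstock_Kurzweil_Integration.integral_diff)

lemma frac_integral_inner:
  fixes f :: "real \<Rightarrow> 'a::euclidean_space"
  assumes "0 < \<alpha>" "0 \<le> s" "continuous_on {0..s} f"
  shows "frac_integral \<alpha> (\<lambda>\<zeta>. f \<zeta> \<bullet> b) s = frac_integral \<alpha> f s \<bullet> b"
  using assms integral_component_eq[OF frac_kernel_integrable_on[OF assms], of b]
  by (simp add: frac_integral_def)

text \<open>The end point \<open>0\<close> is left out because \<open>\<zeta> ^ 0\<close> and \<open>\<zeta> powr 0\<close> differ there (\<open>0 powr 0 = 0\<close>).\<close>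

lemma frac_integral_cong:
  assumes "0 < \<alpha>" "\<And>\<zeta>. \<zeta> \<in> {0<..s} \<Longrightarrow> f \<zeta> = g \<zeta>"
  shows "frac_integral \<alpha> f s = frac_integral \<alpha> g s"
proof -
  have "integral {0..s} (\<lambda>\<zeta>. ((s - \<zeta>) powr (\<alpha> - 1)) *\<^sub>R f \<zeta>)
      = integral {0..s} (\<lambda>\<zeta>. ((s - \<zeta>) powr (\<alpha> - 1)) *\<^sub>R g \<zeta>)"
    by (rule integral_spike[of "{0}"]) (use assms in auto)
  then show ?thesis using assms(1) by (simp add: frac_integral_def)
qed

lemma frac_integral_norm_le:
  fixes f :: "real \<Rightarrow> 'a::euclidean_space"
  assumes "0 < \<alpha>" "0 \<le> s" "continuous_on {0..s} f" "continuous_on {0..s} h"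
    and "\<And>\<zeta>. \<zeta> \<in> {0..s} \<Longrightarrow> norm (f \<zeta>) \<le> h \<zeta>"
  shows "norm (frac_integral \<alpha> f s) \<le> frac_integral \<alpha> h s"
proof -
  have "norm (integral {0..s} (\<lambda>\<zeta>. ((s - \<zeta>) powr (\<alpha> - 1)) *\<^sub>R f \<zeta>))
      \<le> integral {0..s} (\<lambda>\<zeta>. ((s - \<zeta>) powr (\<alpha> - 1)) *\<^sub>R h \<zeta>)"
    using assms
    by (intro integral_norm_bound_integral frac_kernel_integrable_on) (auto intro: mult_left_mono)
  with assms(1) show ?thesis
    by (simp add: frac_integral_def divide_right_mono Gamma_real_pos less_imp_le)
qed

lemma frac_integral_powr_sum:
  fixes c p :: "nat \<Rightarrow> real"
  assumes \<alpha>: "0 < \<alpha>" and s: "0 \<le> s" and p: "\<And>i. i \<le> n \<Longrightarrow> -1 < p i"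
  shows "frac_integral \<alpha> (\<lambda>\<zeta>. \<Sum>i\<le>n. c i * \<zeta> powr p i) s
    = (\<Sum>i\<le>n. c i * (Gamma (p i + 1) / Gamma (p i + 1 + \<alpha>)) * s powr (p i + \<alpha>))"
proof -
  have "((\<lambda>\<zeta>. \<Sum>i\<le>n. c i * ((s - \<zeta>) powr (\<alpha> - 1) * \<zeta> powr p i)) has_integral
      (\<Sum>i\<le>n. c i * (Beta (p i + 1) \<alpha> * s powr (p i + \<alpha>)))) {0..s}"
    by (intro has_integral_sum has_integral_mult_right frac_kernel_powr_has_integral \<alpha> s p) auto
  then have "integral {0..s} (\<lambda>\<zeta>. \<Sum>i\<le>n. c i * ((s - \<zeta>) powr (\<alpha> - 1) * \<zeta> powr p i)) =
      (\<Sum>i\<le>n. c i * (Beta (p i + 1) \<alpha> * s powr (p i + \<alpha>)))"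
    by (rule integral_unique)
  then have "frac_integral \<alpha> (\<lambda>\<zeta>. \<Sum>i\<le>n. c i * \<zeta> powr p i) s
      = (1 / Gamma \<alpha>) * (\<Sum>i\<le>n. c i * (Beta (p i + 1) \<alpha> * s powr (p i + \<alpha>)))"
    using \<alpha> by (simp add: frac_integral_def sum_distrib_left mult_ac)
  also have "\<dots> = (\<Sum>i\<le>n. c i * (Gamma (p i + 1) / Gamma (p i + 1 + \<alpha>)) * s powr (p i + \<alpha>))"
    using Gamma_real_pos[OF \<alpha>] by (simp add: sum_distrib_left Beta_def mult_ac)
  finally show ?thesis .
qed

text \<open>The Gamma quotients produced by two successive integrations telescope, so the semigroup law is
  an identity between coefficients for finite sums of powers.\<close>

lemma frac_integral_semigroup_powr_sum:
  fixes c p :: "nat \<Rightarrow> real"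
  assumes \<alpha>: "0 < \<alpha>" and \<beta>: "0 < \<beta>" and s: "0 \<le> s" and p: "\<And>i. i \<le> n \<Longrightarrow> -1 < p i"
  shows "frac_integral \<alpha> (frac_integral \<beta> (\<lambda>\<zeta>. \<Sum>i\<le>n. c i * \<zeta> powr p i)) s
    = frac_integral (\<alpha> + \<beta>) (\<lambda>\<zeta>. \<Sum>i\<le>n. c i * \<zeta> powr p i) s"
proof -
  let ?c = "\<lambda>i. c i * (Gamma (p i + 1) / Gamma (p i + 1 + \<beta>))"
  have "frac_integral \<alpha> (frac_integral \<beta> (\<lambda>\<zeta>. \<Sum>i\<le>n. c i * \<zeta> powr p i)) s
      = frac_integral \<alpha> (\<lambda>\<zeta>. \<Sum>i\<le>n. ?c i * \<zeta> powr (p i + \<beta>)) s"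
    by (rule frac_integral_cong[OF \<alpha>]) (simp add: frac_integral_powr_sum[OF \<beta> _ p])
  also have "\<dots> = (\<Sum>i\<le>n. ?c i * (Gamma (p i + \<beta> + 1) / Gamma (p i + \<beta> + 1 + \<alpha>)) * s powr (p i + \<beta> + \<alpha>))"
    using p \<beta> by (intro frac_integral_powr_sum \<alpha> s) force
  also have "\<dots> = frac_integral (\<alpha> + \<beta>) (\<lambda>\<zeta>. \<Sum>i\<le>n. c i * \<zeta> powr p i) s"
  proof (subst frac_integral_powr_sum, goal_cases)
    case 4
    have "0 < Gamma (p i + 1 + \<beta>)" if "i \<le> n" for i
      using p[OF that] \<beta> by (intro Gamma_real_pos) simp
    then have "Gamma (p i + 1 + \<beta>) \<noteq> 0" if "i \<le> n" for i
      using that by (metis less_irrefl)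
    then show ?case by (intro sum.cong) (auto simp: add_ac)
  qed (use \<alpha> \<beta> s p in auto)
  finally show ?thesis .
qed

lemma frac_integral_const:
  fixes B :: real
  assumes "0 < \<alpha>" "0 \<le> s"
  shows "frac_integral \<alpha> (\<lambda>_. B) s = B * (s powr \<alpha> / Gamma (1 + \<alpha>))"
proof -
  have "frac_integral \<alpha> (\<lambda>_. B) s = frac_integral \<alpha> (\<lambda>\<zeta>. \<Sum>i\<le>(0::nat). B * \<zeta> powr 0) s"
    by (rule frac_integral_cong) (use assms in auto)
  then show ?thesis using frac_integral_powr_sum[OF assms, of 0 "\<lambda>_. 0" "\<lambda>_. B"] by simp
qed

text \<open>Fractional integration of positive order is a bounded operator for the supremum norm on
  \<open>[0, T]\<close>, with norm at most \<open>T powr \<alpha> / Gamma (1 + \<alpha>)\<close>. Continuity of fractional integrals and the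
  semigroup law therefore pass from polynomials to all continuous functions.\<close>

lemma frac_integral_uniform_limit:
  fixes f :: "real \<Rightarrow> real" and P :: "nat \<Rightarrow> real \<Rightarrow> real"
  assumes \<alpha>: "0 < \<alpha>" and f: "continuous_on {0..T} f" and P: "\<And>n. continuous_on {0..T} (P n)"
    and lim: "uniform_limit {0..T} P f sequentially"
  shows "uniform_limit {0..T} (\<lambda>n. frac_integral \<alpha> (P n)) (frac_integral \<alpha> f) sequentially"
proof (rule uniform_limitI)
  fix e :: real assume e: "0 < e"
  define C where "C = T powr \<alpha> / Gamma (1 + \<alpha>)"
  have \<Gamma>: "0 < Gamma (1 + \<alpha>)" using \<alpha> by (intro Gamma_real_pos) simp
  have C: "0 \<le> C" using \<Gamma> by (simp add: C_def)
  define \<delta> where "\<delta> = e / (C + 1)"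
  have \<delta>: "0 < \<delta>" "\<delta> * C < e" using e C by (auto simp: \<delta>_def field_simps)
  have "\<forall>\<^sub>F n in sequentially. \<forall>x\<in>{0..T}. dist (P n x) (f x) < \<delta>"
    by (rule uniform_limitD[OF lim \<delta>(1)])
  then show "\<forall>\<^sub>F n in sequentially. \<forall>s\<in>{0..T}. dist (frac_integral \<alpha> (P n) s) (frac_integral \<alpha> f s) < e"
  proof (rule eventually_mono, intro ballI)
    fix n s assume n: "\<forall>x\<in>{0..T}. dist (P n x) (f x) < \<delta>" and s: "s \<in> {0..T}"
    have cont: "continuous_on {0..s} f" "continuous_on {0..s} (P n)"
      using s by (auto intro: continuous_on_subset[OF f] continuous_on_subset[OF P])
    have "norm (frac_integral \<alpha> (P n) s - frac_integral \<alpha> f s) = norm (frac_integral \<alpha> (\<lambda>\<zeta>. P n \<zeta> - f \<zeta>) s)"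
      using s cont \<alpha> by (simp add: frac_integral_diff)
    also have "\<dots> \<le> frac_integral \<alpha> (\<lambda>_. \<delta>) s"
      using s n by (intro frac_integral_norm_le \<alpha> continuous_intros cont) (auto simp: dist_norm intro: less_imp_le)
    also have "\<dots> = \<delta> * (s powr \<alpha> / Gamma (1 + \<alpha>))" using s \<alpha> by (simp add: frac_integral_const)
    also have "\<dots> \<le> \<delta> * C" using s \<alpha> \<delta> \<Gamma> unfolding C_def
      by (intro mult_left_mono divide_right_mono powr_mono2) auto
    also have "\<dots> < e" by fact
    finally show "dist (frac_integral \<alpha> (P n) s) (frac_integral \<alpha> f s) < e" by (simp add: dist_norm)
  qed
qed

lemma polynomial_approx:
  fixes f :: "real \<Rightarrow> real"
  assumes "continuous_on {0..T} f"
  obtains P :: "nat \<Rightarrow> real \<Rightarrow> real" where "uniform_limit {0..T} P f sequentially"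
    and "\<And>n. continuous_on {0..T} (P n)"
    and "\<And>n. \<exists>a m. P n = (\<lambda>\<zeta>. \<Sum>i\<le>m. a i * \<zeta> ^ i)"
proof -
  obtain P where lim: "uniform_limit {0..T} P f sequentially" and P: "\<And>n. polynomial_function (P n)"
    using Stone_Weierstrass_uniform_limit[OF compact_Icc assms] by blast
  show thesis
  proof (rule that[OF lim])
    show "continuous_on {0..T} (P n)" for n
      by (rule continuous_on_polymonial_function[OF P])
    show "\<exists>a m. P n = (\<lambda>\<zeta>. \<Sum>i\<le>m. a i * \<zeta> ^ i)" for n
      using P by (metis real_polynomial_function_iff_sum real_polynomial_function_eq)
  qed
qed

lemma frac_integral_polynomial_eq:
  fixes a :: "nat \<Rightarrow> real"
  assumes "0 < \<alpha>"
  shows "frac_integral \<alpha> (\<lambda>\<zeta>. \<Sum>i\<le>m. a i * \<zeta> ^ i) = frac_integral \<alpha> (\<lambda>\<zeta>. \<Sum>i\<le>m. a i * \<zeta> powr real i)"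
  by (rule ext, rule frac_integral_cong[OF assms]) (simp add: powr_realpow)

lemma continuous_on_frac_integral_real:
  fixes f :: "real \<Rightarrow> real"
  assumes \<alpha>: "0 < \<alpha>" and f: "continuous_on {0..T} f"
  shows "continuous_on {0..T} (frac_integral \<alpha> f)"
proof -
  obtain P where lim: "uniform_limit {0..T} P f sequentially"
    and cont: "\<And>n. continuous_on {0..T} (P n)"
    and P: "\<And>n. \<exists>a m. P n = (\<lambda>\<zeta>. \<Sum>i\<le>m. a i * \<zeta> ^ i)"
    using polynomial_approx[OF f] by blast
  have lim': "uniform_limit {0..T} (\<lambda>n. frac_integral \<alpha> (P n)) (frac_integral \<alpha> f) sequentially"
    by (intro frac_integral_uniform_limit \<alpha> f cont lim)
  have "continuous_on {0..T} (frac_integral \<alpha> (P n))" for n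
  proof -
    obtain a m where [simp]: "P n = (\<lambda>\<zeta>. \<Sum>i\<le>m. a i * \<zeta> ^ i)" using P by blast
    have 1: "continuous_on {0..T} (\<lambda>s. \<Sum>i\<le>m. a i * (Gamma (real i + 1) / Gamma (real i + 1 + \<alpha>)) * s powr (real i + \<alpha>))"
      using \<alpha> by (intro continuous_intros continuous_on_powr') auto
    have 2: "frac_integral \<alpha> (P n) s = (\<Sum>i\<le>m. a i * (Gamma (real i + 1) / Gamma (real i + 1 + \<alpha>)) * s powr (real i + \<alpha>))"
      if "s \<in> {0..T}" for s
      using that \<alpha> by (simp add: frac_integral_polynomial_eq frac_integral_powr_sum)
    show ?thesis by (rule continuous_on_eq[OF 1 2[symmetric]])
  qed
  then show ?thesis by (intro uniform_limit_theorem[OF _ lim']) auto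
qed

text \<open>Both sides are limits of their values at approximating polynomials, where the law is already
  known.\<close>

lemma frac_integral_semigroup_real:
  fixes f :: "real \<Rightarrow> real"
  assumes \<alpha>: "0 < \<alpha>" and \<beta>: "0 < \<beta>" and f: "continuous_on {0..T} f" and s: "s \<in> {0..T}"
  shows "frac_integral \<alpha> (frac_integral \<beta> f) s = frac_integral (\<alpha> + \<beta>) f s"
proof -
  obtain P where lim: "uniform_limit {0..T} P f sequentially"
    and cont: "\<And>n. continuous_on {0..T} (P n)"
    and P: "\<And>n. \<exists>a m. P n = (\<lambda>\<zeta>. \<Sum>i\<le>m. a i * \<zeta> ^ i)"
    using polynomial_approx[OF f] by blast
  have "uniform_limit {0..T} (\<lambda>n. frac_integral \<alpha> (frac_integral \<beta> (P n))) (frac_integral \<alpha> (frac_integral \<beta> f)) sequentially"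
    by (intro frac_integral_uniform_limit continuous_on_frac_integral_real \<alpha> \<beta> f cont lim)
  then have 1: "(\<lambda>n. frac_integral \<alpha> (frac_integral \<beta> (P n)) s) \<longlonglongrightarrow> frac_integral \<alpha> (frac_integral \<beta> f) s"
    using s by (rule tendsto_uniform_limitI)
  have "uniform_limit {0..T} (\<lambda>n. frac_integral (\<alpha> + \<beta>) (P n)) (frac_integral (\<alpha> + \<beta>) f) sequentially"
    using \<alpha> \<beta> by (intro frac_integral_uniform_limit f cont lim) simp
  then have 2: "(\<lambda>n. frac_integral (\<alpha> + \<beta>) (P n) s) \<longlonglongrightarrow> frac_integral (\<alpha> + \<beta>) f s"
    using s by (rule tendsto_uniform_limitI)
  have "frac_integral \<alpha> (frac_integral \<beta> (P n)) s = frac_integral (\<alpha> + \<beta>) (P n) s" for n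
  proof -
    obtain a m where [simp]: "P n = (\<lambda>\<zeta>. \<Sum>i\<le>m. a i * \<zeta> ^ i)" using P by blast
    show ?thesis
      using \<alpha> \<beta> s by (simp add: frac_integral_polynomial_eq frac_integral_semigroup_powr_sum)
  qed
  with 1 2 show ?thesis by (simp add: LIMSEQ_unique)
qed

lemma frac_integral_1:
  fixes f :: "real \<Rightarrow> real"
  shows "frac_integral 1 f s = integral {0..s} f"
proof -
  have "integral {0..s} f = integral {0..s} (\<lambda>\<zeta>. (s - \<zeta>) powr 0 *\<^sub>R f \<zeta>)"
    \<comment> \<open>at \<open>\<zeta> = s\<close> the kernel is \<open>0 powr 0 = 0\<close> instead of \<open>1\<close>\<close>
    by (rule integral_spike[of "{s}"]) auto
  then show ?thesis by (simp add: frac_integral_def)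
qed

lemma frac_integral_0_right: "0 < \<alpha> \<Longrightarrow> frac_integral \<alpha> f 0 = 0"
  by (simp add: frac_integral_def)

text \<open>Write \<open>I\<^sup>r\<close> for the fractional integral of order \<open>r\<close>. Integrating the derivative gives
  \<open>I\<^sup>1\<^sup>-\<^sup>q y = I\<^sup>1 g\<close>. Applying \<open>I\<^sup>q\<close> and the semigroup law, \<open>I\<^sup>1 y = I\<^sup>1 (I\<^sup>q g)\<close>, and one
  differentiates this identity between integrals of continuous functions. Order \<open>q = 1\<close> is separate,
  since \<open>I\<^sup>0\<close> is the identity by convention and not given by the kernel.\<close>

lemma riemann_liouville_derivative_imp_frac_integral:
  fixes y g :: "real \<Rightarrow> real"
  assumes T: "0 < T" and q: "0 < q" "q \<le> 1"
    and y: "continuous_on {0..T} y" and y0: "y 0 = 0" and g: "continuous_on {0..T} g"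
    and D: "\<And>s. s \<in> {0..T} \<Longrightarrow> (frac_integral (1 - q) y has_vector_derivative g s) (at s within {0..T})"
    and s: "s \<in> {0..T}"
  shows "y s = frac_integral q g s"
proof -
  have G: "frac_integral (1 - q) y r = frac_integral 1 g r" if r: "r \<in> {0..T}" for r
  proof -
    have "(g has_integral (frac_integral (1 - q) y r - frac_integral (1 - q) y 0)) {0..r}"
      using r by (intro fundamental_theorem_of_calculus has_vector_derivative_within_subset[OF D]) auto
    moreover have "frac_integral (1 - q) y 0 = 0"
      using y0 by (simp add: frac_integral_def)
    ultimately show ?thesis by (simp add: frac_integral_1 integral_unique)
  qed
  show ?thesis
  proof (cases "q = 1")
    case True
    then show ?thesis using G[OF s] by (simp add: frac_integral_def)
  next
    case False
    with q have q1: "0 < 1 - q" by simp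
    have I: "integral {0..r} y = integral {0..r} (frac_integral q g)" if r: "r \<in> {0..T}" for r
    proof -
      have "integral {0..r} y = frac_integral (q + (1 - q)) y r" by (simp add: frac_integral_1)
      also have "\<dots> = frac_integral q (frac_integral (1 - q) y) r"
        by (rule frac_integral_semigroup_real[OF q(1) q1 y r, symmetric])
      also have "\<dots> = frac_integral q (frac_integral 1 g) r"
        using r by (intro frac_integral_cong q G) auto
      also have "\<dots> = frac_integral (1 + q) g r"
        using frac_integral_semigroup_real[OF q(1) zero_less_one g r] by (simp add: add.commute)
      also have "\<dots> = frac_integral 1 (frac_integral q g) r"
        using frac_integral_semigroup_real[OF zero_less_one q(1) g r] by simp
      finally show ?thesis by (simp add: frac_integral_1)
    qed
    have "((\<lambda>r. integral {0..r} (frac_integral q g)) has_vector_derivative frac_integral q g s) (at s within {0..T})"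
      by (intro integral_has_vector_derivative continuous_on_frac_integral_real q g s)
    then have "((\<lambda>r. integral {0..r} y) has_vector_derivative frac_integral q g s) (at s within {0..T})"
      by (rule has_vector_derivative_transform[OF s I, rotated])
    moreover have "((\<lambda>r. integral {0..r} y) has_vector_derivative y s) (at s within {0..T})"
      by (intro integral_has_vector_derivative y s)
    ultimately show ?thesis
      using vector_derivative_unique_within_closed_interval[of 0 T s] T s by (simp add: cbox_interval)
  qed
qed

text \<open>The scalar case, applied to \<open>z \<bullet> b\<close> for every vector \<open>b\<close>.\<close>

lemma caputo_derivative_imp_integral_equation:
  fixes z g :: "real \<Rightarrow> 'a::euclidean_space"
  assumes T: "0 < T" and q: "0 < q" "q \<le> 1"
    and z: "continuous_on {0..T} z" and g: "continuous_on {0..T} g"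
    and D: "has_caputo_derivative_on q T z g" and s: "s \<in> {0..T}"
  shows "z s = z 0 + frac_integral q g s"
proof -
  have "(z s - z 0) \<bullet> b = frac_integral q g s \<bullet> b" for b
  proof -
    let ?y = "\<lambda>\<zeta>. (z \<zeta> - z 0) \<bullet> b"
    have comp: "frac_integral (1 - q) ?y r = frac_integral (1 - q) (\<lambda>\<zeta>. z \<zeta> - z 0) r \<bullet> b"
      if "r \<in> {0..T}" for r
    proof (cases "q = 1")
      case False
      with that q show ?thesis
        by (intro frac_integral_inner continuous_intros continuous_on_subset[OF z]) auto
    qed (simp add: frac_integral_def)
    have "?y s = frac_integral q (\<lambda>\<zeta>. g \<zeta> \<bullet> b) s"
    proof (rule riemann_liouville_derivative_imp_frac_integral[OF T q _ _ _ _ s])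
      fix r assume r: "r \<in> {0..T}"
      have "((\<lambda>r. frac_integral (1 - q) (\<lambda>\<zeta>. z \<zeta> - z 0) r \<bullet> b) has_vector_derivative g r \<bullet> b) (at r within {0..T})"
        using D r unfolding has_caputo_derivative_on_def
        by (intro bounded_linear.has_vector_derivative[OF bounded_linear_inner_left]) auto
      then show "(frac_integral (1 - q) ?y has_vector_derivative g r \<bullet> b) (at r within {0..T})"
        by (rule has_vector_derivative_transform[OF r comp, rotated])
    qed (auto intro!: continuous_intros z g)
    also have "\<dots> = frac_integral q g s \<bullet> b"
      using s by (intro frac_integral_inner q continuous_on_subset[OF g]) auto
    finally show ?thesis .
  qed
  then have "z s - z 0 = frac_integral q g s" by (intro vector_eq_rdot[THEN iffD1]) auto
  then show ?thesis by (simp add: algebra_simps)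
qed

section \<open>A fractional Gronwall inequality\<close>

text \<open>With \<open>t = \<mu> * (s - \<zeta>)\<close> the left side becomes \<open>exp (\<mu> * s) / \<mu> powr q\<close> times an incomplete Gamma integral
  divided by \<open>Gamma q\<close>. So, measured in the weight \<open>exp (\<mu> * s)\<close>, fractional integration has norm at
  most \<open>1 / \<mu> powr q\<close>, which is small for large \<open>\<mu>\<close>.\<close>

lemma frac_integral_exp_le:
  fixes q \<mu> s :: real
  assumes q: "0 < q" and \<mu>: "0 < \<mu>" and s: "0 \<le> s"
  shows "frac_integral q (\<lambda>\<zeta>. exp (\<mu> * \<zeta>)) s \<le> exp (\<mu> * s) / \<mu> powr q"
proof -
  define h :: "real \<Rightarrow> real" where "h = (\<lambda>t. t powr (q - 1) / exp t)"
  have "h integrable_on {0..}"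
    using Gamma_integral_real[OF q] by (auto simp: h_def integrable_on_def)
  then have int: "h integrable_on {0..\<mu> * s}"
    by (rule integrable_on_subinterval) auto
  have le: "integral {0..\<mu> * s} h \<le> Gamma q"
    by (rule has_integral_subset_le[OF _ integrable_integral[OF int] Gamma_integral_real[OF q, folded h_def]])
      (auto simp: h_def)
  have img: "(\<lambda>x. s - x / \<mu>) ` {0..\<mu> * s} = {0..s}"
  proof (intro equalityI subsetI)
    fix x assume "x \<in> {0..s}"
    then show "x \<in> (\<lambda>x. s - x / \<mu>) ` {0..\<mu> * s}"
      using \<mu> by (intro image_eqI[of _ _ "\<mu> * (s - x)"]) (auto simp: field_simps)
  qed (use \<mu> in \<open>auto simp: field_simps\<close>)
  have "(h has_integral integral {0..\<mu> * s} h) (cbox 0 (\<mu> * s))"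
    using int by auto
  from has_integral_affinity[OF this, of "- \<mu>" "\<mu> * s"] \<mu>
  have "((\<lambda>\<zeta>. h (\<mu> * s - \<mu> * \<zeta>)) has_integral (integral {0..\<mu> * s} h / \<mu>)) {0..s}"
    by (simp add: img)
  from has_integral_mult_right[OF this, of "exp (\<mu> * s) / \<mu> powr (q - 1)"]
  have "((\<lambda>\<zeta>. exp (\<mu> * s) / \<mu> powr (q - 1) * h (\<mu> * s - \<mu> * \<zeta>)) has_integral
      (exp (\<mu> * s) / \<mu> powr q * integral {0..\<mu> * s} h)) {0..s}"
    using \<mu> by (simp add: powr_diff)
  moreover have "exp (\<mu> * s) / \<mu> powr (q - 1) * h (\<mu> * s - \<mu> * \<zeta>)
      = (s - \<zeta>) powr (q - 1) * exp (\<mu> * \<zeta>)" if "\<zeta> \<in> {0..s}" for \<zeta>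
  proof -
    have "\<mu> * s - \<mu> * \<zeta> = \<mu> * (s - \<zeta>)" by (simp add: algebra_simps)
    then have "(\<mu> * s - \<mu> * \<zeta>) powr (q - 1) = \<mu> powr (q - 1) * (s - \<zeta>) powr (q - 1)"
      using that \<mu> by (simp add: powr_mult)
    then show ?thesis using \<mu> by (simp add: h_def exp_diff)
  qed
  ultimately have "((\<lambda>\<zeta>. (s - \<zeta>) powr (q - 1) * exp (\<mu> * \<zeta>)) has_integral
      (exp (\<mu> * s) / \<mu> powr q * integral {0..\<mu> * s} h)) {0..s}"
    by (rule has_integral_eq[rotated])
  then have "frac_integral q (\<lambda>\<zeta>. exp (\<mu> * \<zeta>)) s = (exp (\<mu> * s) / \<mu> powr q) * (integral {0..\<mu> * s} h / Gamma q)"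
    using q by (simp add: frac_integral_def integral_unique)
  also have "\<dots> \<le> (exp (\<mu> * s) / \<mu> powr q) * 1"
    using le Gamma_real_pos[OF q] by (intro mult_left_mono) auto
  finally show ?thesis by simp
qed

text \<open>Let \<open>M\<close> be the maximum of \<open>exp (- \<mu> * s) * norm (e s)\<close>. The previous bound gives
  \<open>M \<le> (\<epsilon> + L * M) / \<mu> powr q\<close>; the exponent with \<open>\<mu> powr q = 2 * L\<close> makes the right side
  \<open>\<epsilon> / (2 * L) + M / 2\<close>, hence \<open>M \<le> \<epsilon> / L\<close>. The constant \<open>\<epsilon>\<close> is absorbed into the weight, since
  \<open>1 \<le> exp (\<mu> * \<zeta>)\<close>.\<close>

lemma fractional_gronwall:
  fixes e h :: "real \<Rightarrow> 'a::euclidean_space"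
  assumes q: "0 < q" and L: "0 < L" and \<epsilon>: "0 \<le> \<epsilon>"
    and e: "continuous_on {0..T} e" and h: "continuous_on {0..T} h"
    and eq: "\<And>s. s \<in> {0..T} \<Longrightarrow> e s = frac_integral q h s"
    and bound: "\<And>s. s \<in> {0..T} \<Longrightarrow> norm (h s) \<le> \<epsilon> + L * norm (e s)"
    and s: "s \<in> {0..T}"
  shows "norm (e s) \<le> exp ((2 * L) powr (1 / q) * T) / L * \<epsilon>"
proof -
  define \<mu> where "\<mu> = (2 * L) powr (1 / q)"
  have \<mu>: "0 < \<mu>" and \<mu>q: "\<mu> powr q = 2 * L"
    using L q by (auto simp: \<mu>_def powr_powr)
  define \<rho> where "\<rho> = (\<lambda>s. exp (- \<mu> * s) * norm (e s))"
  have "continuous_on {0..T} \<rho>"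
    unfolding \<rho>_def by (intro continuous_intros e)
  then obtain r where r: "r \<in> {0..T}" and max: "\<And>s. s \<in> {0..T} \<Longrightarrow> \<rho> s \<le> \<rho> r"
    using continuous_attains_sup[of "{0..T}" \<rho>] s by auto
  have weighted: "norm (e s) = exp (\<mu> * s) * \<rho> s" for s
    by (simp add: \<rho>_def exp_minus field_simps)
  have "norm (h \<zeta>) \<le> (\<epsilon> + L * \<rho> r) * exp (\<mu> * \<zeta>)" if \<zeta>: "\<zeta> \<in> {0..r}" for \<zeta>
  proof -
    have \<zeta>': "\<zeta> \<in> {0..T}" using \<zeta> r by auto
    have "\<epsilon> * 1 \<le> \<epsilon> * exp (\<mu> * \<zeta>)"
      using \<epsilon> \<zeta> \<mu> by (intro mult_left_mono) auto
    moreover have "L * norm (e \<zeta>) \<le> L * (exp (\<mu> * \<zeta>) * \<rho> r)"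
      unfolding weighted using L max[OF \<zeta>'] by (intro mult_left_mono) auto
    ultimately show ?thesis using bound[OF \<zeta>'] by (simp add: algebra_simps)
  qed
  then have "norm (frac_integral q h r) \<le> frac_integral q (\<lambda>\<zeta>. (\<epsilon> + L * \<rho> r) * exp (\<mu> * \<zeta>)) r"
    using r by (intro frac_integral_norm_le q continuous_on_subset[OF h] continuous_intros) auto
  also have "\<dots> = (\<epsilon> + L * \<rho> r) * frac_integral q (\<lambda>\<zeta>. exp (\<mu> * \<zeta>)) r"
    using q by (simp add: frac_integral_def mult.left_commute)
  also have "\<dots> \<le> (\<epsilon> + L * \<rho> r) * (exp (\<mu> * r) / (2 * L))"
    using frac_integral_exp_le[OF q \<mu>, of r] r \<mu>q \<epsilon> L
    by (intro mult_left_mono) (auto simp: \<rho>_def)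
  finally have "exp (\<mu> * r) * \<rho> r \<le> (\<epsilon> + L * \<rho> r) * (exp (\<mu> * r) / (2 * L))"
    unfolding eq[OF r, symmetric] weighted .
  then have "exp (\<mu> * r) * \<rho> r \<le> exp (\<mu> * r) * ((\<epsilon> + L * \<rho> r) / (2 * L))"
    by (simp add: mult.commute)
  then have "\<rho> r \<le> (\<epsilon> + L * \<rho> r) / (2 * L)"
    by (rule mult_left_le_imp_le) simp
  then have "\<rho> r \<le> \<epsilon> / L" using L by (simp add: field_simps)
  then have "\<rho> s \<le> \<epsilon> / L" using max[OF s] by simp
  moreover have "exp (\<mu> * s) \<le> exp (\<mu> * T)" using s \<mu> by auto
  moreover have "0 \<le> \<rho> s" by (simp add: \<rho>_def)
  ultimately have "norm (e s) \<le> exp (\<mu> * T) * (\<epsilon> / L)"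
    unfolding weighted by (intro mult_mono) auto
  then show ?thesis by (simp add: \<mu>_def)
qed

section \<open>A lower bound for the Mittag-Leffler function\<close>

text \<open>Only the part of the Gamma integral over \<open>[R, R + 1]\<close> is kept. As \<open>R\<close> is arbitrary, this shows that
  Gamma outgrows every exponential.\<close>

lemma Gamma_ge_powr:
  fixes R x :: real
  assumes R: "0 < R" and x: "0 \<le> x"
  shows "R powr x * exp (- (R + 1)) \<le> Gamma (x + 1)"
proof -
  define h :: "real \<Rightarrow> real" where "h = (\<lambda>t. t powr x / exp t)"
  have h: "(h has_integral Gamma (x + 1)) {0..}"
    using Gamma_integral_real[of "x + 1"] x by (simp add: h_def)
  then have int: "h integrable_on {R..R + 1}"
    using R by (intro integrable_on_subinterval[of h "{0..}"]) (auto simp: integrable_on_def)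
  have "((\<lambda>t. R powr x * exp (- (R + 1))) has_integral (R powr x * exp (- (R + 1)))) {R..R + 1}"
    using has_integral_const_real[of "R powr x * exp (- (R + 1))" R "R + 1"] by simp
  moreover have "R powr x * exp (- (R + 1)) \<le> h t" if "t \<in> {R..R + 1}" for t
    using that R x by (auto simp: h_def divide_inverse simp flip: exp_minus intro!: mult_mono powr_mono2)
  ultimately have "R powr x * exp (- (R + 1)) \<le> integral {R..R + 1} h"
    by (rule has_integral_le[OF _ integrable_integral[OF int]])
  also have "\<dots> \<le> Gamma (x + 1)"
    by (rule has_integral_subset_le[OF _ integrable_integral[OF int] h]) (use R in \<open>auto simp: h_def\<close>)
  finally show ?thesis .
qed

text \<open>The term of index \<open>0\<close> equals \<open>1\<close> and all terms are nonnegative, so the point is convergence of the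
  series. It follows from the lower bound on Gamma with \<open>R powr q = 2 * s + 1\<close>, which leaves a
  geometric series of ratio \<open>s / (2 * s + 1) < 1\<close>.\<close>

lemma one_le_mittag_leffler:
  fixes q s :: real
  assumes q: "0 < q" and s: "0 \<le> s"
  shows "1 \<le> mittag_leffler q s"
proof -
  define R where "R = (2 * s + 1) powr (1 / q)"
  have R: "0 < R" and Rq: "R powr q = 2 * s + 1"
    using q s by (auto simp: R_def powr_powr)
  define r where "r = s / (2 * s + 1)"
  have r: "0 \<le> r" "r < 1" using s by (auto simp: r_def)
  have \<Gamma>: "0 < Gamma (real n * q + 1)" for n
    using q by (intro Gamma_real_pos) (simp add: add_nonneg_pos)
  have le: "norm (s ^ n / Gamma (real n * q + 1)) \<le> exp (R + 1) * r ^ n" for n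
  proof -
    have "R powr (real n * q) = (2 * s + 1) ^ n"
      using s by (simp add: mult.commute[of _ q] powr_realpow Rq flip: powr_powr)
    with Gamma_ge_powr[OF R, of "real n * q"] q
    have "(2 * s + 1) ^ n * exp (- (R + 1)) \<le> Gamma (real n * q + 1)" by simp
    then have "s ^ n / Gamma (real n * q + 1) \<le> s ^ n / ((2 * s + 1) ^ n * exp (- (R + 1)))"
      using s \<Gamma>[of n] by (intro divide_left_mono mult_pos_pos zero_less_power) auto
    also have "\<dots> = exp (R + 1) * r ^ n"
      unfolding exp_minus[of "R + 1"] r_def by (simp add: power_mult_distrib power_inverse divide_inverse mult_ac)
    finally show ?thesis using s \<Gamma>[of n] by simp
  qed
  have "summable (\<lambda>n. s ^ n / Gamma (real n * q + 1))"
    by (rule summable_comparison_test'[OF _ le]) (use r in \<open>auto intro!: summable_mult summable_geometric\<close>)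
  then have "(\<Sum>n\<in>{0}. s ^ n / Gamma (real n * q + 1)) \<le> mittag_leffler q s"
    unfolding mittag_leffler_def using s \<Gamma> by (intro sum_le_suminf) (auto intro!: divide_nonneg_pos)
  then show ?thesis by simp
qed

section \<open>Lipschitz dependence of the quasi-variational inequality on its parameter\<close>

text \<open>The constraint sets \<open>\<Phi> u + C\<close> are translates of one set. Hence \<open>u2\<close> shifted by \<open>\<Phi> u1 - \<Phi> u2\<close>, called
  \<open>w\<close> below, is admissible for the inequality of \<open>u1\<close>, and \<open>u1\<close> shifted by the opposite vector is
  admissible for that of \<open>u2\<close>. Strong pseudomonotonicity turns the first inequality into
  \<open>\<eta> * (norm (w - u1))\<^sup>2 \<le> F w x1 \<bullet> (w - u1)\<close>, and the second one reads \<open>F u2 x2 \<bullet> (w - u1) \<le> 0\<close>.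
  Subtracting leaves only a difference of values of \<open>F\<close>, controlled by its Lipschitz constant:
  \<open>norm (w - u1) \<le> (\<Lambda> / \<eta>) * (norm (x2 - x1) + norm \<delta>)\<close>, where the shift satisfies
  \<open>norm \<delta> \<le> p * norm (u2 - u1)\<close>. The contraction hypothesis absorbs the resulting multiple of
  \<open>norm (u2 - u1)\<close>.\<close>

lemma qvi_moving_set_lipschitz:
  fixes F :: "'u::real_inner \<Rightarrow> 'x::real_normed_vector \<Rightarrow> 'u" and \<Phi> :: "'u \<Rightarrow> 'u"
  assumes \<eta>: "0 < \<eta>" and \<Lambda>: "0 \<le> \<Lambda>" and small: "(\<Lambda> / \<eta> + 1) * p < 1"
    and mono: "\<And>x u1 u2. 0 \<le> F u1 x \<bullet> (u2 - u1) \<Longrightarrow> \<eta> * (norm (u2 - u1))\<^sup>2 \<le> F u2 x \<bullet> (u2 - u1)"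
    and F_lip: "\<And>x1 x2 u1 u2. norm (F u1 x1 - F u2 x2) \<le> \<Lambda> * (norm (x1 - x2) + norm (u1 - u2))"
    and \<Phi>_lip: "\<And>u1 u2. norm (\<Phi> u1 - \<Phi> u2) \<le> p * norm (u1 - u2)"
    and u1: "u1 - \<Phi> u1 \<in> C" "\<And>v. v - \<Phi> u1 \<in> C \<Longrightarrow> 0 \<le> F u1 x1 \<bullet> (v - u1)"
    and u2: "u2 - \<Phi> u2 \<in> C" "\<And>v. v - \<Phi> u2 \<in> C \<Longrightarrow> 0 \<le> F u2 x2 \<bullet> (v - u2)"
  shows "norm (u2 - u1) \<le> (\<Lambda> / \<eta>) / (1 - (\<Lambda> / \<eta> + 1) * p) * norm (x2 - x1)"
proof -
  define \<delta> where "\<delta> = \<Phi> u2 - \<Phi> u1"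
  define w where "w = u2 - \<delta>"
  define N where "N = norm (w - u1)"
  have \<delta>_le: "norm \<delta> \<le> p * norm (u2 - u1)" using \<Phi>_lip by (simp add: \<delta>_def)
  have "0 \<le> F u1 x1 \<bullet> (w - u1)" using u2(1) by (intro u1(2)) (simp add: w_def \<delta>_def)
  then have lower: "\<eta> * N\<^sup>2 \<le> F w x1 \<bullet> (w - u1)" unfolding N_def by (rule mono)
  have "0 \<le> F u2 x2 \<bullet> (u1 + \<delta> - u2)" using u1(1) by (intro u2(2)) (simp add: \<delta>_def)
  then have upper: "F u2 x2 \<bullet> (w - u1) \<le> 0" by (simp add: w_def inner_diff_right inner_add_right)
  have "\<eta> * N\<^sup>2 \<le> (F w x1 - F u2 x2) \<bullet> (w - u1)"
    using lower upper by (simp add: inner_diff_left)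
  also have "\<dots> \<le> norm (F w x1 - F u2 x2) * N"
    unfolding N_def by (rule norm_cauchy_schwarz)
  also have "\<dots> \<le> (\<Lambda> * (norm (x2 - x1) + norm \<delta>)) * N"
    using F_lip[of w x1 u2 x2]
    by (intro mult_right_mono) (auto simp: w_def N_def norm_minus_commute)
  finally have "\<eta> * N * N \<le> \<Lambda> * (norm (x2 - x1) + norm \<delta>) * N"
    by (simp add: power2_eq_square mult.assoc)
  moreover have "0 \<le> N" "0 \<le> \<Lambda> * (norm (x2 - x1) + norm \<delta>)" using \<Lambda> by (auto simp: N_def)
  ultimately have "\<eta> * N \<le> \<Lambda> * (norm (x2 - x1) + norm \<delta>)"
    by (cases "N = 0") (auto simp: mult_le_cancel_right)
  then have N_le: "N \<le> (\<Lambda> / \<eta>) * (norm (x2 - x1) + norm \<delta>)"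
    using \<eta> by (simp add: field_simps)
  have "norm (u2 - u1) \<le> N + norm \<delta>"
    using norm_triangle_ineq[of "w - u1" \<delta>] by (simp add: N_def w_def)
  also have "\<dots> \<le> (\<Lambda> / \<eta>) * norm (x2 - x1) + (\<Lambda> / \<eta> + 1) * norm \<delta>"
    using N_le by (simp add: algebra_simps)
  also have "\<dots> \<le> (\<Lambda> / \<eta>) * norm (x2 - x1) + (\<Lambda> / \<eta> + 1) * (p * norm (u2 - u1))"
    using \<delta>_le \<Lambda> \<eta> by (intro add_left_mono mult_left_mono) auto
  finally have "(1 - (\<Lambda> / \<eta> + 1) * p) * norm (u2 - u1) \<le> (\<Lambda> / \<eta>) * norm (x2 - x1)"
    by (simp add: algebra_simps)
  then have "norm (u2 - u1) \<le> ((\<Lambda> / \<eta>) * norm (x2 - x1)) / (1 - (\<Lambda> / \<eta> + 1) * p)"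
    using small by (subst pos_le_divide_eq) (simp_all only: mult.commute diff_gt_0_iff_gt)
  then show ?thesis by (simp only: times_divide_eq_left)
qed

text \<open>Since \<open>sqrt (4 * \<Lambda>\<^sup>2 + 2 * \<eta>\<^sup>2) \<ge> 2 * \<Lambda>\<close>, twice the bracket is at least \<open>8 * \<Lambda>\<^sup>2 + 2 * \<eta>\<^sup>2\<close>, which
  exceeds \<open>(\<Lambda> + \<eta>)\<^sup>2\<close>.\<close>

lemma smallness_imp_contraction:
  fixes \<eta> \<Lambda> p :: real
  assumes \<eta>: "0 < \<eta>" and \<Lambda>: "0 \<le> \<Lambda>"
    and small: "2 * (p\<^sup>2 / \<eta>\<^sup>2) * (\<Lambda> * sqrt (4 * \<Lambda>\<^sup>2 + 2 * \<eta>\<^sup>2) + 2 * \<Lambda>\<^sup>2 + \<eta>\<^sup>2) < 1"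
  shows "(\<Lambda> / \<eta> + 1) * p < 1"
proof -
  have "2 * \<Lambda> \<le> sqrt (4 * \<Lambda>\<^sup>2 + 2 * \<eta>\<^sup>2)"
    by (rule real_le_rsqrt) (simp add: power_mult_distrib)
  then have "\<Lambda> * (2 * \<Lambda>) \<le> \<Lambda> * sqrt (4 * \<Lambda>\<^sup>2 + 2 * \<eta>\<^sup>2)"
    using \<Lambda> by (rule mult_left_mono)
  then have "2 * \<Lambda>\<^sup>2 \<le> \<Lambda> * sqrt (4 * \<Lambda>\<^sup>2 + 2 * \<eta>\<^sup>2)"
    by (simp only: power2_eq_square mult.left_commute)
  moreover have "2 * \<Lambda> * \<eta> \<le> \<Lambda>\<^sup>2 + \<eta>\<^sup>2"
    by (rule sum_squares_bound)
  moreover have "0 \<le> \<Lambda>\<^sup>2" "0 \<le> \<eta>\<^sup>2" by simp_all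
  ultimately have "(\<Lambda> + \<eta>)\<^sup>2 \<le> 2 * (\<Lambda> * sqrt (4 * \<Lambda>\<^sup>2 + 2 * \<eta>\<^sup>2) + 2 * \<Lambda>\<^sup>2 + \<eta>\<^sup>2)"
    unfolding power2_sum by argo
  then have "(p\<^sup>2 / \<eta>\<^sup>2) * (\<Lambda> + \<eta>)\<^sup>2
      \<le> (p\<^sup>2 / \<eta>\<^sup>2) * (2 * (\<Lambda> * sqrt (4 * \<Lambda>\<^sup>2 + 2 * \<eta>\<^sup>2) + 2 * \<Lambda>\<^sup>2 + \<eta>\<^sup>2))"
    by (rule mult_left_mono) simp
  also have "\<dots> < 1" using small by (simp only: mult.assoc mult.left_commute)
  moreover have "((\<Lambda> / \<eta> + 1) * p)\<^sup>2 = (p\<^sup>2 / \<eta>\<^sup>2) * (\<Lambda> + \<eta>)\<^sup>2"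
    using \<eta> by (simp add: power2_eq_square field_simps)
  ultimately have "((\<Lambda> / \<eta> + 1) * p)\<^sup>2 < 1\<^sup>2" by simp
  then show ?thesis by (rule power2_less_imp_less) simp
qed

lemma omit_in_omit_space: "omit j u \<in> omit_space j"
  by (simp add: omit_def omit_space_def)

lemma omit_dist_le_norm: "omit_dist j (omit j u) (omit j v) \<le> norm (u - v)"
proof -
  have "omit_dist j (omit j u) (omit j v) = L2_set (\<lambda>i. u $ i - v $ i) (- {j})"
    unfolding omit_dist_def by (rule L2_set_cong) (auto simp: omit_def)
  also have "\<dots> \<le> L2_set (\<lambda>i. u $ i - v $ i) UNIV"
    unfolding L2_set_def by (intro real_sqrt_le_mono sum_mono2) auto
  also have "\<dots> = norm (u - v)"
    by (simp add: norm_vec_def L2_set_def)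
  finally show ?thesis .
qed

lemma norm_le_norm1_mult:
  fixes v l :: "real ^ 'm::finite"
  assumes "0 \<le> r" and "\<And>j. \<bar>v $ j\<bar> \<le> l $ j * r"
  shows "norm v \<le> norm1 l * r"
proof -
  have "norm v \<le> (\<Sum>j\<in>UNIV. \<bar>v $ j\<bar>)" by (rule norm_le_l1_cart)
  also have "\<dots> \<le> (\<Sum>j\<in>UNIV. \<bar>l $ j\<bar> * r)"
    using assms(1) by (intro sum_mono order_trans[OF assms(2)] mult_right_mono) auto
  finally show ?thesis by (simp add: norm1_def sum_distrib_right)
qed

text \<open>Here \<open>F = S - D\<close>, and the constraint set of \<open>u\<close> is the fixed box with corners \<open>c\<close> and \<open>d\<close> translated by
  the vector of the values of the \<open>\<phi> j\<close>, so the estimate for translated sets applies.\<close>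

lemma qvi_solution_lipschitz:
  fixes S D :: "'m::finite \<Rightarrow> real ^ 'm \<Rightarrow> real ^ 'n::finite \<Rightarrow> real"
    and a b \<phi> :: "'m \<Rightarrow> ('m \<Rightarrow> real) \<Rightarrow> real" and l lS lD c d :: "real ^ 'm"
  assumes \<eta>: "0 < \<eta>"
    and mono: "\<And>x u1 u2.
      (\<Sum>j\<in>UNIV. S j u1 x * (u2 $ j - u1 $ j)) + (\<Sum>j\<in>UNIV. D j u1 x * (u1 $ j - u2 $ j)) \<ge> 0 \<Longrightarrow>
      (\<Sum>j\<in>UNIV. S j u2 x * (u2 $ j - u1 $ j)) + (\<Sum>j\<in>UNIV. D j u2 x * (u1 $ j - u2 $ j))
        \<ge> \<eta> * (norm (u2 - u1))\<^sup>2"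
    and S_lip: "\<And>j x1 x2 u1 u2.
      \<bar>S j u1 x1 - S j u2 x2\<bar> \<le> lS $ j * (norm (x1 - x2) + norm (u1 - u2))"
    and D_lip: "\<And>j x1 x2 u1 u2.
      \<bar>D j u1 x1 - D j u2 x2\<bar> \<le> lD $ j * (norm (x1 - x2) + norm (u1 - u2))"
    and a: "\<And>j p. p \<in> omit_space j \<Longrightarrow> a j p = \<phi> j p + c $ j"
    and b: "\<And>j p. p \<in> omit_space j \<Longrightarrow> b j p = \<phi> j p + d $ j"
    and \<phi>_lip: "\<And>j. omit_lipschitz j (l $ j) (\<phi> j)"
    and contraction: "((norm1 lS + norm1 lD) / \<eta> + 1) * norm1 l < 1"
    and sol: "qvi_solution S D a b x1 u1" "qvi_solution S D a b x2 u2"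
  shows "norm (u2 - u1) \<le> ((norm1 lS + norm1 lD) / \<eta>)
    / (1 - ((norm1 lS + norm1 lD) / \<eta> + 1) * norm1 l) * norm (x2 - x1)"
proof -
  define F where "F = (\<lambda>u x. (\<chi> j. S j u x) - (\<chi> j. D j u x))"
  define \<Phi> where "\<Phi> = (\<lambda>u :: real ^ 'm. \<chi> j. \<phi> j (omit j u))"
  define C where "C = {w :: real ^ 'm. \<forall>j. c $ j \<le> w $ j \<and> w $ j \<le> d $ j}"
  have K: "constraint_set a b u = {w. w - \<Phi> u \<in> C}" for u
    by (auto simp: constraint_set_def C_def \<Phi>_def a b omit_in_omit_space algebra_simps)
  have F_inner: "F u x \<bullet> (u2 - u1) = (\<Sum>j\<in>UNIV. S j u x * (u2 $ j - u1 $ j)) + (\<Sum>j\<in>UNIV. D j u x * (u1 $ j - u2 $ j))"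
    for u x u1 u2
    by (simp add: F_def inner_vec_def algebra_simps flip: sum.distrib)
  have 1: "norm ((\<chi> j. S j u1 x1) - (\<chi> j. S j u2 x2)) \<le> norm1 lS * (norm (x1 - x2) + norm (u1 - u2))"
    for u1 u2 x1 x2 by (rule norm_le_norm1_mult) (use S_lip in auto)
  have 2: "norm ((\<chi> j. D j u1 x1) - (\<chi> j. D j u2 x2)) \<le> norm1 lD * (norm (x1 - x2) + norm (u1 - u2))"
    for u1 u2 x1 x2 by (rule norm_le_norm1_mult) (use D_lip in auto)
  show ?thesis
  proof (rule qvi_moving_set_lipschitz[where F = F and \<Phi> = \<Phi> and C = C])
    show "norm (F u1 x1 - F u2 x2) \<le> (norm1 lS + norm1 lD) * (norm (x1 - x2) + norm (u1 - u2))" for x1 x2 u1 u2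
    proof -
      have "F u1 x1 - F u2 x2 = ((\<chi> j. S j u1 x1) - (\<chi> j. S j u2 x2)) - ((\<chi> j. D j u1 x1) - (\<chi> j. D j u2 x2))"
        by (simp add: F_def)
      then show ?thesis
        using norm_triangle_ineq4 1[of u1 x1 u2 x2] 2[of u1 x1 u2 x2]
        by (smt (verit) distrib_right)
    qed
    show "norm (\<Phi> u1 - \<Phi> u2) \<le> norm1 l * norm (u1 - u2)" for u1 u2
    proof (rule norm_le_norm1_mult)
      show "0 \<le> norm (u1 - u2)" by simp
      fix j
      have "\<bar>\<phi> j (omit j u1) - \<phi> j (omit j u2)\<bar> \<le> l $ j * omit_dist j (omit j u1) (omit j u2)"
        using \<phi>_lip[of j] by (auto simp: omit_lipschitz_def omit_in_omit_space)
      also have "\<dots> \<le> l $ j * norm (u1 - u2)"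
        using \<phi>_lip[of j] by (intro mult_left_mono omit_dist_le_norm) (auto simp: omit_lipschitz_def)
      finally show "\<bar>(\<Phi> u1 - \<Phi> u2) $ j\<bar> \<le> l $ j * norm (u1 - u2)" by (simp add: \<Phi>_def)
    qed
    show "\<eta> * (norm (u2 - u1))\<^sup>2 \<le> F u2 x \<bullet> (u2 - u1)" if "0 \<le> F u1 x \<bullet> (u2 - u1)" for x u1 u2
      using mono that unfolding F_inner .
    show "0 \<le> norm1 lS + norm1 lD" by (simp add: norm1_def sum_nonneg)
  qed (use \<eta> contraction sol in \<open>auto simp: qvi_solution_def K F_def\<close>)
qed

section \<open>Mittag-Leffler-Hyers-Ulam stability\<close>

theorem theorem5p6:
  fixes T q :: real and k :: nat and t \<iota> :: "nat \<Rightarrow> real"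
    and x0 :: "real ^ 'n::finite"
    and S D :: "'m::finite \<Rightarrow> real ^ 'm \<Rightarrow> real ^ 'n \<Rightarrow> real"
    and a b \<phi> :: "'m \<Rightarrow> ('m \<Rightarrow> real) \<Rightarrow> real"
    and chi :: "real \<Rightarrow> real ^ 'n \<Rightarrow> real ^ 'n"
    and theta :: "real \<Rightarrow> real ^ 'n \<Rightarrow> real ^ 'm \<Rightarrow> real ^ 'n"
    and \<eta> :: real and l lS lD c d :: "real ^ 'm"
  assumes T: "0 < T" and q: "0 < q" "q \<le> 1"
    and t_range: "\<And>i. i \<in> {1..k} \<Longrightarrow> 0 < t i \<and> t i < T"
    and t_mono: "\<And>i. i \<in> {1..<k} \<Longrightarrow> t i \<le> t (Suc i)"
    and A1_pos: "0 < \<eta>" "\<And>j. 0 < lS $ j" "\<And>j. 0 < lD $ j"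
    and A1_mono: "\<And>x u1 u2.
      (\<Sum>j\<in>UNIV. S j u1 x * (u2 $ j - u1 $ j)) + (\<Sum>j\<in>UNIV. D j u1 x * (u1 $ j - u2 $ j)) \<ge> 0 \<Longrightarrow>
      (\<Sum>j\<in>UNIV. S j u2 x * (u2 $ j - u1 $ j)) + (\<Sum>j\<in>UNIV. D j u2 x * (u1 $ j - u2 $ j))
        \<ge> \<eta> * (norm (u2 - u1))\<^sup>2"
    and A1_S: "\<And>j x1 x2 u1 u2.
      \<bar>S j u1 x1 - S j u2 x2\<bar> \<le> lS $ j * (norm (x1 - x2) + norm (u1 - u2))"
    and A1_D: "\<And>j x1 x2 u1 u2.
      \<bar>D j u1 x1 - D j u2 x2\<bar> \<le> lD $ j * (norm (x1 - x2) + norm (u1 - u2))"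
    and A2_cd: "\<And>j. 0 < c $ j \<and> c $ j < d $ j"
    and A2_a: "\<And>j p. p \<in> omit_space j \<Longrightarrow> a j p = \<phi> j p + c $ j"
    and A2_b: "\<And>j p. p \<in> omit_space j \<Longrightarrow> b j p = \<phi> j p + d $ j"
    and A2_lip: "\<And>j. omit_lipschitz j (l $ j) (\<phi> j)"
    and A2_small: "2 * ((norm1 l)\<^sup>2 / \<eta>\<^sup>2) *
      ((norm1 lS + norm1 lD) * sqrt (4 * (norm1 lS + norm1 lD)\<^sup>2 + 2 * \<eta>\<^sup>2)
        + 2 * (norm1 lS + norm1 lD)\<^sup>2 + \<eta>\<^sup>2) < 1"
    and A3_cont: "continuous_on ({0..T} \<times> UNIV \<times> UNIV) (\<lambda>(s, x, u). theta s x u)"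
    and A3_lip: "\<exists>L>0. \<forall>s\<in>{0..T}. \<forall>x1 x2 u1 u2.
      norm (theta s x2 u2 - theta s x1 u1) \<le> L * (norm (x2 - x1) + norm (u2 - u1))"
    and A4_cont: "continuous_on ({0..T} \<times> UNIV) (\<lambda>(s, x). chi s x)"
    and A4_lip: "\<exists>L>0. \<forall>s\<in>{0..T}. \<forall>x1 x2.
      norm (chi s x2 - chi s x1) \<le> L * norm (x2 - x1)"
    and A5: "0 < (\<Sum>i=1..k. \<bar>\<iota> i\<bar>)" "(\<Sum>i=1..k. \<bar>\<iota> i\<bar>) < 1"
  shows "pcp_mlhu_stable T q k t \<iota> x0 chi theta S D a b"
proof -
  obtain L\<theta> where L\<theta>: "0 < L\<theta>" and \<theta>_lip: "\<And>s x1 x2 u1 u2. s \<in> {0..T} \<Longrightarrow>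
      norm (theta s x2 u2 - theta s x1 u1) \<le> L\<theta> * (norm (x2 - x1) + norm (u2 - u1))"
    using A3_lip by blast
  obtain L\<chi> where L\<chi>: "0 < L\<chi>" and \<chi>_lip: "\<And>s x1 x2. s \<in> {0..T} \<Longrightarrow>
      norm (chi s x2 - chi s x1) \<le> L\<chi> * norm (x2 - x1)"
    using A4_lip by blast
  have \<Lambda>: "0 \<le> norm1 lS + norm1 lD" by (simp add: norm1_def sum_nonneg)
  have contraction: "((norm1 lS + norm1 lD) / \<eta> + 1) * norm1 l < 1"
    by (rule smallness_imp_contraction[OF A1_pos(1) \<Lambda> A2_small])
  define \<kappa> where "\<kappa> = ((norm1 lS + norm1 lD) / \<eta>) / (1 - ((norm1 lS + norm1 lD) / \<eta> + 1) * norm1 l)"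
  have \<kappa>: "0 \<le> \<kappa>"
    using \<Lambda> A1_pos(1) contraction by (simp add: \<kappa>_def)
  have qvi_lip: "norm (u2 - u1) \<le> \<kappa> * norm (x2 - x1)"
    if "qvi_solution S D a b x1 u1" "qvi_solution S D a b x2 u2" for x1 x2 u1 u2
    unfolding \<kappa>_def
    by (rule qvi_solution_lipschitz[OF A1_pos(1) A1_mono A1_S A1_D A2_a A2_b A2_lip contraction that])
  define L where "L = L\<chi> + L\<theta> * (1 + \<kappa>)"
  have L: "0 < L" using L\<theta> L\<chi> \<kappa> by (simp add: L_def add_pos_nonneg)
  define C where "C = exp ((2 * L) powr (1 / q) * T) / L"
  have C: "0 < C" using L by (simp add: C_def)
  have "norm (z s - x s) \<le> C * \<epsilon> * mittag_leffler q s"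
    if \<epsilon>: "0 < \<epsilon>" and approx: "pcp_approx_solution T q chi theta S D a b \<epsilon> z w"
      and sol: "pcp_solution T q k t \<iota> x0 chi theta S D a b x u" and init: "z 0 = x 0"
      and s: "s \<in> {0..T}" for \<epsilon> z w x u s
  proof -
    define f where "f = (\<lambda>\<zeta>. chi \<zeta> (x \<zeta>) + theta \<zeta> (x \<zeta>) (u \<zeta>))"
    have zc: "continuous_on {0..T} z" and wc: "continuous_on {0..T} w"
      and zq: "\<And>s. s \<in> {0..T} \<Longrightarrow> qvi_solution S D a b (z s) (w s)"
      using approx by (auto simp: pcp_approx_solution_def)
    obtain g where gc: "continuous_on {0..T} g" and gD: "has_caputo_derivative_on q T z g"
      and g: "\<And>s. s \<in> {0..T} \<Longrightarrow> norm (g s - chi s (z s) - theta s (z s) (w s)) \<le> \<epsilon>"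
      using approx by (auto simp: pcp_approx_solution_def)
    have xc: "continuous_on {0..T} x" and uc: "continuous_on {0..T} u"
      and xq: "\<And>s. s \<in> {0..T} \<Longrightarrow> qvi_solution S D a b (x s) (u s)"
      and xeq: "\<And>s. s \<in> {0..T} \<Longrightarrow> x s = x0 + (\<Sum>i=1..k. \<iota> i *\<^sub>R x (t i)) + frac_integral q f s"
      using sol unfolding pcp_solution_def f_def by blast+
    have fc: "continuous_on {0..T} f"
    proof -
      have "continuous_on {0..T} (\<lambda>s. (\<lambda>(s, x). chi s x) (s, x s))"
        by (rule continuous_on_compose2[OF A4_cont]) (auto intro!: continuous_intros xc)
      moreover have "continuous_on {0..T} (\<lambda>s. (\<lambda>(s, x, u). theta s x u) (s, x s, u s))"
        by (rule continuous_on_compose2[OF A3_cont]) (auto intro!: continuous_intros xc uc)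
      ultimately show ?thesis unfolding f_def by (auto intro: continuous_on_add)
    qed
    \<comment> \<open>the nonlocal terms are absorbed into the initial value, which \<open>z\<close> shares\<close>
    have "x 0 = x0 + (\<Sum>i=1..k. \<iota> i *\<^sub>R x (t i))"
      using xeq[of 0] T q by (simp add: frac_integral_0_right)
    then have eq: "z r - x r = frac_integral q (\<lambda>\<zeta>. g \<zeta> - f \<zeta>) r" if r: "r \<in> {0..T}" for r
      using caputo_derivative_imp_integral_equation[OF T q zc gc gD r] xeq[OF r] init r q
      by (subst frac_integral_diff) (auto intro: continuous_on_subset[OF gc] continuous_on_subset[OF fc])
    have bound: "norm (g r - f r) \<le> \<epsilon> + L * norm (z r - x r)" if r: "r \<in> {0..T}" for r
    proof -
      have "g r - f r = (g r - chi r (z r) - theta r (z r) (w r)) + (chi r (z r) - chi r (x r))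
          + (theta r (z r) (w r) - theta r (x r) (u r))" by (simp add: f_def)
      then have "norm (g r - f r) \<le> norm (g r - chi r (z r) - theta r (z r) (w r))
          + norm (chi r (z r) - chi r (x r)) + norm (theta r (z r) (w r) - theta r (x r) (u r))"
        by (metis norm_triangle_le norm_triangle_ineq add_right_mono)
      also have "\<dots> \<le> \<epsilon> + L\<chi> * norm (z r - x r) + L\<theta> * (norm (z r - x r) + norm (w r - u r))"
        by (intro add_mono g \<chi>_lip \<theta>_lip r)
      also have "\<dots> \<le> \<epsilon> + L\<chi> * norm (z r - x r) + L\<theta> * (norm (z r - x r) + \<kappa> * norm (z r - x r))"
        using L\<theta> by (intro add_left_mono mult_left_mono qvi_lip xq zq r) auto
      also have "\<dots> = \<epsilon> + L * norm (z r - x r)" by (simp add: L_def algebra_simps)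
      finally show ?thesis .
    qed
    have "norm (z s - x s) \<le> C * \<epsilon>"
      unfolding C_def
      by (rule fractional_gronwall[OF q(1) L _ _ _ eq bound s])
        (use \<epsilon> in \<open>auto intro!: continuous_intros zc xc gc fc\<close>)
    also have "\<dots> \<le> C * \<epsilon> * mittag_leffler q s"
      using one_le_mittag_leffler[OF q(1), of s] s C \<epsilon> by simp
    finally show ?thesis .
  qed
  with C show ?thesis unfolding pcp_mlhu_stable_def by blast
qed

end
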